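(* Let $\mathcal{L}_n=\{L_1,L_2,\ldots,L_n\}$ ($n\ge 3$) be an infinity type line arrangement in the plane (with the conventions in the context) with an infinity permutation $\sigma\in S_n$ and nomenclature $\sigma(1)^{a_1}\sigma(2)^{a_2}\sigma(3)^{a_3}\ldots\sigma(n)^{a_n}$, where $a_i\in\{+1,-1\}$ for $1\leq i\leq n$. Let $1\leq i<j<k\leq n$. If the lines $L_{\sigma(i)},L_{\sigma(j)},L_{\sigma(k)}$ form a triangle of $\mathcal{L}_n$, then the following necessary condition holds: (1) either no integer of the set $\{\sigma(1),\sigma(2),\ldots,\sigma(k)\}$ lies strictly between $\sigma(i)$ and $\sigma(j)$, (2) or all integers of the set $\{\sigma(1),\sigma(2),\ldots,\sigma(k)\}$ lie between $\sigma(i)$ and $\sigma(j)$ (including the end values). In addition to this necessary condition, the lines $L_{\sigma(i)},L_{\sigma(j)},L_{\sigma(k)}$ form a triangle of the line arrangement $\mathcal{L}_n$ if and only if one of the following holds: - $i=1$, $j=2$, $k=3$; - or else (1) occurs and (a) $a_k=\operatorname{sign}\big(a_j(\sigma(j)-\sigma(i))(\sigma(k)-\sigma(j))\big)$, and (b) for every $l$ with $j<l<k$, $a_l=-\operatorname{sign}\big(a_j(\sigma(j)-\sigma(i))(\sigma(l)-\sigma(j))\big)$; - or else (2) occurs, $a_k=a_j$, and for every $l$ with $j<l<k$, $a_l=-\operatorname{sign}(a_j)$.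
   Context: Line arrangement: a finite set $\mathcal{L}_n=\{L_1,\ldots,L_n\}$ of lines in $\mathbb{R}^2$, no two parallel and no three concurrent. Convention: the angle $\theta_i$ of $L_i$ with respect to the positive $X$-axis satisfies $0<\theta_1<\theta_2<\cdots<\theta_n<\pi$; moreover (after a translation of the arrangement) all intersection points of pairs of lines lie in the first quadrant and every line meets the positive $X$-axis. The symbol $\pi$ denotes the number; $\sigma$ denotes a permutation. Triangle of an arrangement: three lines form a triangle of the arrangement if the triangle they bound is a (bounded) region of the arrangement, i.e. it is not subdivided by the other lines. Line at infinity: a line $L$ is a line at infinity with respect to a line arrangement $\mathcal{L}$ if $\mathcal{L}\cup\{L\}$ is a line arrangement and all vertices (pairwise intersection points of lines of $\mathcal{L}$) lie on one side of $L$ (the side being allowed to include the line $L$ itself if $L\in\mathcal{L}$). Infinity type: $\mathcal{L}_n$ is an infinity type line arrangement if there is a permutation $\sigma\in S_n$ such that for each $2\leq l\leq n$ the line $L_{\sigma(l)}$ is a line at infinity with respect to $\{L_{\sigma(1)},\ldots,L_{\sigma(l-1)}\}$. Such a $\sigma$ is called an infinity permutation of $\mathcal{L}_n$ (not necessarily unique). Nomenclature: given an infinity permutation $\sigma$, the nomenclature is the string $\sigma(1)^{a_1}\sigma(2)^{a_2}\ldots\sigma(n)^{a_n}$ with superscripts $a_l\in\{+1,-1\}$ defined as follows. For $l\in\{1,2,3\}$: $a_l=+1$ if $L_{\sigma(l)}$ does not separate the origin from the intersection point of the other two lines among $L_{\sigma(1)},L_{\sigma(2)},L_{\sigma(3)}$,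 and $a_l=-1$ if it does. For $l\geq 4$: $a_l=+1$ if $L_{\sigma(l)}$ does not separate the origin from the vertices of the arrangement $\{L_{\sigma(1)},\ldots,L_{\sigma(l-1)}\}$ (which all lie on one side of $L_{\sigma(l)}$), and $a_l=-1$ if it does. *)

theory Defs
  imports "HOL-Analysis.Analysis" "HOL-Combinatorics.Permutations"
begin

definition is_line :: "(real^2) set \<Rightarrow> bool" where
  "is_line L \<longleftrightarrow> affine L \<and> aff_dim L = 1"

definition line_arrangement :: "(real^2) set set \<Rightarrow> bool" where
  "line_arrangement A \<longleftrightarrow>
     finite A \<and>
     (\<forall>L\<in>A. is_line L) \<and>
     (\<forall>L\<in>A. \<forall>M\<in>A. L \<noteq> M \<longrightarrow> \<not> affine_parallel L M) \<and>
     (\<forall>L\<in>A. \<forall>M\<in>A. \<forall>N\<in>A. L \<noteq> M \<and> L \<noteq> N \<and> M \<noteq> N \<longrightarrow> L \<inter> M \<inter> N = {})"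

definition vertices :: "(real^2) set set \<Rightarrow> (real^2) set" where
  "vertices A = {p. \<exists>L\<in>A. \<exists>M\<in>A. L \<noteq> M \<and> p \<in> L \<and> p \<in> M}"

definition has_angle :: "(real^2) set \<Rightarrow> real \<Rightarrow> bool" where
  "has_angle L \<theta> \<longleftrightarrow>
     0 \<le> \<theta> \<and> \<theta> < pi \<and> (\<exists>p. L = range (\<lambda>t. p + t *\<^sub>R vector [cos \<theta>, sin \<theta>]))"

text \<open>The lines \<open>L 1, \<dots>, L n\<close> form a line arrangement in the standard position: they are
  numbered by increasing angle, all vertices lie in the open first quadrant, and every line
  meets the positive X-axis.\<close>

definition numbered_arrangement :: "nat \<Rightarrow> (nat \<Rightarrow> (real^2) set) \<Rightarrow> bool" where
  "numbered_arrangement n L \<longleftrightarrow>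
     line_arrangement (L ` {1..n}) \<and>
     (\<exists>\<theta>. (\<forall>i\<in>{1..n}. 0 < \<theta> i \<and> \<theta> i < pi \<and> has_angle (L i) (\<theta> i)) \<and>
          strict_mono_on {1..n} \<theta>) \<and>
     (\<forall>p\<in>vertices (L ` {1..n}). p $ 1 > 0 \<and> p $ 2 > 0) \<and>
     (\<forall>i\<in>{1..n}. \<exists>x>0. vector [x, 0] \<in> L i)"

text \<open>The regions are the connected components of the complement of the lines. The open
  triangle bounded by three lines is spanned by their three intersection points.\<close>

definition regions :: "(real^2) set set \<Rightarrow> (real^2) set set" where
  "regions A = components (- \<Union>A)"

definition form_triangle ::
    "(real^2) set set \<Rightarrow> (real^2) set \<Rightarrow> (real^2) set \<Rightarrow> (real^2) set \<Rightarrow> bool" where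
  "form_triangle A L M N \<longleftrightarrow>
     L \<in> A \<and> M \<in> A \<and> N \<in> A \<and> L \<noteq> M \<and> L \<noteq> N \<and> M \<noteq> N \<and>
     interior (convex hull (vertices {L, M, N})) \<in> regions A"

text \<open>Replacing \<open>(a, b)\<close> by \<open>(- a, - b)\<close> gives the opposite half-plane, so this set consists of
  both open sides of a line.\<close>

definition sides :: "(real^2) set \<Rightarrow> (real^2) set set" where
  "sides L = {H. \<exists>a b. a \<noteq> 0 \<and> L = {x. a \<bullet> x = b} \<and> H = {x. a \<bullet> x < b}}"

definition separates :: "(real^2) set \<Rightarrow> (real^2) set \<Rightarrow> (real^2) set \<Rightarrow> bool" where
  "separates L S T \<longleftrightarrow> (\<exists>H\<in>sides L. \<exists>K\<in>sides L. H \<noteq> K \<and> S \<subseteq> H \<and> T \<subseteq> K)"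

definition line_at_infinity :: "(real^2) set \<Rightarrow> (real^2) set set \<Rightarrow> bool" where
  "line_at_infinity L A \<longleftrightarrow>
     line_arrangement (insert L A) \<and>
     (\<exists>H\<in>sides L. vertices A \<subseteq> (if L \<in> A then H \<union> L else H))"

definition infinity_permutation ::
    "nat \<Rightarrow> (nat \<Rightarrow> (real^2) set) \<Rightarrow> (nat \<Rightarrow> nat) \<Rightarrow> bool" where
  "infinity_permutation n L \<sigma> \<longleftrightarrow>
     \<sigma> permutes {1..n} \<and>
     (\<forall>l\<in>{2..n}. line_at_infinity (L (\<sigma> l)) ((\<lambda>m. L (\<sigma> m)) ` {1..<l}))"

definition infinity_type :: "nat \<Rightarrow> (nat \<Rightarrow> (real^2) set) \<Rightarrow> bool" where
  "infinity_type n L \<longleftrightarrow> (\<exists>\<sigma>. infinity_permutation n L \<sigma>)"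

text \<open>For \<open>l \<le> 3\<close> the only vertex of the arrangement of the other two among the first three lines
  is their intersection point.\<close>

definition superscript :: "(nat \<Rightarrow> (real^2) set) \<Rightarrow> (nat \<Rightarrow> nat) \<Rightarrow> nat \<Rightarrow> int" where
  "superscript L \<sigma> l =
     (if separates (L (\<sigma> l)) {0}
           (vertices ((\<lambda>m. L (\<sigma> m)) ` (if l \<le> 3 then {1, 2, 3} - {l} else {1..<l})))
      then -1 else 1)"

definition nomenclature ::
    "nat \<Rightarrow> (nat \<Rightarrow> (real^2) set) \<Rightarrow> (nat \<Rightarrow> nat) \<Rightarrow> (nat \<times> int) list" where
  "nomenclature n L \<sigma> = map (\<lambda>l. (\<sigma> l, superscript L \<sigma> l)) [1..<Suc n]"

definition none_strictly_between :: "(nat \<Rightarrow> nat) \<Rightarrow> nat \<Rightarrow> nat \<Rightarrow> nat \<Rightarrow> bool" where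
  "none_strictly_between \<sigma> i j k \<longleftrightarrow>
     \<sigma> ` {1..k} \<inter> {min (\<sigma> i) (\<sigma> j)<..<max (\<sigma> i) (\<sigma> j)} = {}"

definition all_between :: "(nat \<Rightarrow> nat) \<Rightarrow> nat \<Rightarrow> nat \<Rightarrow> nat \<Rightarrow> bool" where
  "all_between \<sigma> i j k \<longleftrightarrow> \<sigma> ` {1..k} \<subseteq> {min (\<sigma> i) (\<sigma> j)..max (\<sigma> i) (\<sigma> j)}"

end

(*
  Write the line L m as f m = 0, where f m x = sin (\<theta> m) x_1 - cos (\<theta> m) x_2 - d m; since d m > 0,
  the origin lies on the negative side of every line, so a_l is minus the sign of f on the earlier
  vertices. For three lines p, q, r the value of f p at the vertex of q and r is
  D p q r / sin (\<theta> r - \<theta> q) with an alternating determinant D, and the sign of the denominator is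
  that of r - q. Three lines bound a region iff no further line has two of their vertices on
  different sides. A line later than k never does. For an earlier line l, exchanging arguments of D
  replaces every sign needed by one of a_j, a_k, a_l times a product of signs of differences of the
  values of \<sigma>. What remains is a computation with signs.
*)

theory Submission
  imports Defs
begin

section \<open>Sides of a hyperplane and separation from the origin\<close>

lemma sidesI_less: "a \<noteq> 0 \<Longrightarrow> {x. a \<bullet> x < b} \<in> sides {x. a \<bullet> x = b}"
  by (auto simp: sides_def)

lemma sidesI_greater: "a \<noteq> 0 \<Longrightarrow> {x. b < a \<bullet> x} \<in> sides {x. a \<bullet> x = b}"
proof -
  assume "a \<noteq> 0"
  moreover have "{x. a \<bullet> x = b} = {x. (- a) \<bullet> x = - b}" "{x. b < a \<bullet> x} = {x. (- a) \<bullet> x < - b}"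
    by auto
  ultimately show ?thesis
    unfolding sides_def mem_Collect_eq by (intro exI[of _ "- a"] exI[of _ "- b"]) auto
qed

text \<open>An open half-space of the first equation is connected and misses the hyperplane, so by
  the intermediate value theorem the second linear form cannot change sign on it. Since
  \<open>sides\<close> ranges over all equations of a line, this frees it from the choice of
  equation.\<close>

lemma hyperplane_same_side:
  fixes a a' x y :: "'a::euclidean_space"
  assumes eq: "{x. a \<bullet> x = b} = {x. a' \<bullet> x = b'}"
    and pos: "(a \<bullet> x - b) * (a \<bullet> y - b) > 0"
  shows "(a' \<bullet> x - b') * (a' \<bullet> y - b') > 0"
proof (rule ccontr)
  assume "\<not> ?thesis"
  then have opp: "a' \<bullet> x \<le> b' \<and> b' \<le> a' \<bullet> y \<or> a' \<bullet> y \<le> b' \<and> b' \<le> a' \<bullet> x"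
    by (smt (verit) mult_pos_pos mult_neg_neg)
  obtain S where S: "connected S" "x \<in> S" "y \<in> S" "S \<inter> {x. a \<bullet> x = b} = {}"
  proof (cases "a \<bullet> x < b")
    case True
    with pos have "a \<bullet> y < b" by (smt (verit) zero_less_mult_iff)
    with True show ?thesis
      by (intro that[of "{x. a \<bullet> x < b}"])
         (auto simp: convex_connected convex_halfspace_lt)
  next
    case False
    with pos have "a \<bullet> y > b" "a \<bullet> x > b" by (smt (verit) zero_less_mult_iff)+
    then show ?thesis
      by (intro that[of "{x. a \<bullet> x > b}"])
         (auto simp: convex_connected convex_halfspace_gt)
  qed
  from opp obtain z where "z \<in> S" "a' \<bullet> z = b'"
    using connected_ivt_hyperplane[OF S(1)] S(2,3) by metis
  with S(4) eq show False by blast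
qed

lemma sides_same_side:
  assumes "H \<in> sides {x. a \<bullet> x = b}" "x \<in> H" "y \<in> H"
  shows "(a \<bullet> x - b) * (a \<bullet> y - b) > 0"
proof -
  obtain a' b' where *: "{x. a' \<bullet> x = b'} = {x. a \<bullet> x = b}" "H = {x. a' \<bullet> x < b'}"
    using assms(1) by (auto simp: sides_def)
  show ?thesis
    by (rule hyperplane_same_side[OF *(1)]) (use * assms in \<open>auto simp: mult_neg_neg\<close>)
qed

lemma sides_closed_same_side:
  assumes "H \<in> sides {x. a \<bullet> x = b}" "x \<in> H" "(a \<bullet> x - b) * (a \<bullet> y - b) > 0"
  shows "y \<in> H"
proof -
  obtain a' b' where *: "{x. a \<bullet> x = b} = {x. a' \<bullet> x = b'}" "H = {x. a' \<bullet> x < b'}"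
    using assms(1) by (auto simp: sides_def)
  show ?thesis
    using hyperplane_same_side[OF *(1) assms(3)] assms(2) *(2)
    by (auto simp: zero_less_mult_iff)
qed

text \<open>As \<open>b > 0\<close>, the origin satisfies \<open>a \<bullet> x < b\<close>; as
  \<open>T\<close> stays within one side, the single point \<open>t\<close> decides for all of
  \<open>T\<close>.\<close>

lemma separates_origin_iff:
  assumes H: "H \<in> sides {x. a \<bullet> x = b}" "T \<subseteq> H" and t: "t \<in> T"
    and a: "a \<noteq> 0" and b: "b > 0"
  shows "separates {x. a \<bullet> x = b} {0} T \<longleftrightarrow> a \<bullet> t > b"
proof
  assume "separates {x. a \<bullet> x = b} {0} T"
  then obtain K K' where K: "K \<in> sides {x. a \<bullet> x = b}" "K' \<in> sides {x. a \<bullet> x = b}" "K \<noteq> K'"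
      "0 \<in> K" "t \<in> K'"
    using t by (auto simp: separates_def)
  show "a \<bullet> t > b"
  proof (rule ccontr)
    assume "\<not> a \<bullet> t > b"
    moreover have "a \<bullet> t \<noteq> b"
      using sides_same_side[OF K(2) K(5) K(5)] by auto
    ultimately have "a \<bullet> t < b" by simp
    then have "t \<in> K"
      using sides_closed_same_side[OF K(1) K(4), of t] b by (simp add: mult_less_0_iff)
    \<comment> \<open>A side contains exactly the points lying on the same side as any one of its
      members, so two sides sharing \<open>t\<close> coincide.\<close>
    then have "K = K'"
      using sides_closed_same_side sides_same_side K by (metis subsetI subset_antisym)
    with K(3) show False by simp
  qed
next
  assume gt: "a \<bullet> t > b"
  have "T \<subseteq> {x. b < a \<bullet> x}"
  proof
    fix x assume "x \<in> T"
    then show "x \<in> {x. b < a \<bullet> x}"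
      using sides_same_side[OF H(1), of t x] gt t H(2) by (auto simp: zero_less_mult_iff)
  qed
  moreover have "t \<in> {x. b < a \<bullet> x}" "t \<notin> {x. a \<bullet> x < b}" using gt by auto
  ultimately show "separates {x. a \<bullet> x = b} {0} T"
    unfolding separates_def using sidesI_less[OF a, of b] sidesI_greater[OF a, of b] b
    by (intro bexI[of _ "{x. a \<bullet> x < b}"] bexI[of _ "{x. b < a \<bullet> x}"]) auto
qed

text \<open>To be applied with \<open>a\<close>, \<open>b\<close>, \<open>c\<close> the values of
  one line's equation at the corners of a triangle; it then decides whether that line enters the
  open triangle.\<close>

lemma positive_combination_zero_iff:
  fixes a b c :: real
  assumes "a \<noteq> 0" "b \<noteq> 0" "c \<noteq> 0"
  shows "(\<exists>x y z. 0 < x \<and> 0 < y \<and> 0 < z \<and> x + y + z = 1 \<and> x * a + y * b + z * c = 0) \<longleftrightarrow>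
    \<not> (0 < a \<and> 0 < b \<and> 0 < c \<or> a < 0 \<and> b < 0 \<and> c < 0)"
    (is "?L \<longleftrightarrow> \<not> ?R")
proof
  assume ?L
  then obtain x y z where *: "0 < x" "0 < y" "0 < z" "x * a + y * b + z * c = 0" by blast
  show "\<not> ?R"
    using * mult_pos_pos[of x a] mult_pos_pos[of y b] mult_pos_pos[of z c]
      mult_pos_neg[of x a] mult_pos_neg[of y b] mult_pos_neg[of z c] by linarith
next
  assume nR: "\<not> ?R"
  have normalise: ?L if "0 < x" "0 < y" "0 < z" "x * a + y * b + z * c = 0" for x y z
  proof -
    define w where "w = x + y + z"
    have w: "w > 0" using that by (simp add: w_def)
    have "x / w + y / w + z / w = 1" using w by (simp add: w_def flip: add_divide_distrib)
    moreover have "x / w * a + y / w * b + z / w * c = 0"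
      using that(4) by (simp flip: add_divide_distrib)
    ultimately show ?thesis using that w
      by (intro exI[of _ "x/w"] exI[of _ "y/w"] exI[of _ "z/w"]) auto
  qed
  \<comment> \<open>One of the three numbers has the sign opposite to the other two. Each of those
    two gets the absolute value of the odd one as weight, and the odd one gets the absolute value of
    their sum, so the terms cancel.\<close>
  consider "a * b > 0" "a * c < 0" | "a * b < 0" "a * c > 0" | "a * b < 0" "a * c < 0"
    using nR assms by (smt (verit) mult_pos_pos mult_neg_neg mult_pos_neg mult_neg_pos)
  then show ?L
  proof cases
    case 1
    then show ?thesis
      using normalise[of "\<bar>c\<bar>" "\<bar>c\<bar>" "\<bar>a + b\<bar>"]
      by (auto simp: zero_less_mult_iff mult_less_0_iff algebra_simps)
  next
    case 2
    then show ?thesis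
      using normalise[of "\<bar>b\<bar>" "\<bar>a + c\<bar>" "\<bar>b\<bar>"]
      by (auto simp: zero_less_mult_iff mult_less_0_iff algebra_simps)
  next
    case 3
    then show ?thesis
      using normalise[of "\<bar>b + c\<bar>" "\<bar>a\<bar>" "\<bar>a\<bar>"]
      by (auto simp: zero_less_mult_iff mult_less_0_iff algebra_simps)
  qed
qed

section \<open>Lines given by angle and offset\<close>

text \<open>The unit direction vector turned clockwise by a right angle. Its first coordinate is
  positive for \<open>0 < t < pi\<close>, which makes the offset of a line meeting the positive
  X-axis positive.\<close>

definition normal :: "real \<Rightarrow> real^2" where
  "normal t = vector [sin t, - cos t]"

lemma inner_normal: "normal t \<bullet> x = sin t * x $ 1 - cos t * x $ 2"
  by (simp add: normal_def inner_vec_def sum_2)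

lemma normal_nonzero [simp]: "normal t \<noteq> 0"
proof
  assume "normal t = 0"
  then have "normal t $ 1 = 0" "normal t $ 2 = 0" by simp_all
  then have "sin t = 0" "cos t = 0" by (simp_all add: normal_def)
  then show False using sin_cos_squared_add[of t] by simp
qed

lemma has_angle_hyperplane:
  assumes "has_angle L t"
  obtains d where "L = {x. normal t \<bullet> x = d}"
proof -
  obtain p where p: "L = range (\<lambda>s. p + s *\<^sub>R vector [cos t, sin t])"
    using assms by (auto simp: has_angle_def)
  have "L = {x. normal t \<bullet> x = normal t \<bullet> p}"
  proof (intro set_eqI iffI)
    fix x assume "x \<in> L"
    then show "x \<in> {x. normal t \<bullet> x = normal t \<bullet> p}"
      by (auto simp: p inner_normal algebra_simps)
  next
    fix x assume "x \<in> {x. normal t \<bullet> x = normal t \<bullet> p}"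
    then have e: "sin t * (x $ 1 - p $ 1) = cos t * (x $ 2 - p $ 2)"
      by (simp add: inner_normal algebra_simps)
    \<comment> \<open>The inner product of \<open>x - p\<close> with the unit direction, hence the
      parameter of \<open>x\<close> on the line.\<close>
    define s where "s = cos t * (x $ 1 - p $ 1) + sin t * (x $ 2 - p $ 2)"
    have sc: "sin t * sin t + cos t * cos t = 1"
      using sin_cos_squared_add[of t] by (simp add: power2_eq_square)
    have "x $ 1 - p $ 1 = s * cos t"
    proof -
      have "s * cos t = cos t * cos t * (x $ 1 - p $ 1) + sin t * (cos t * (x $ 2 - p $ 2))"
        by (simp add: s_def algebra_simps)
      also have "\<dots> = (sin t * sin t + cos t * cos t) * (x $ 1 - p $ 1)"
        unfolding e[symmetric] by (simp only: algebra_simps)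
      finally show ?thesis by (simp add: sc)
    qed
    moreover have "x $ 2 - p $ 2 = s * sin t"
    proof -
      have "s * sin t = cos t * (sin t * (x $ 1 - p $ 1)) + sin t * sin t * (x $ 2 - p $ 2)"
        by (simp add: s_def algebra_simps)
      also have "\<dots> = (sin t * sin t + cos t * cos t) * (x $ 2 - p $ 2)"
        unfolding e by (simp only: algebra_simps)
      finally show ?thesis by (simp add: sc)
    qed
    ultimately have "x = p + s *\<^sub>R vector [cos t, sin t]"
      by (simp add: vec_eq_iff forall_2 algebra_simps)
    then show "x \<in> L" unfolding p by blast
  qed
  then show ?thesis by (rule that)
qed

section \<open>Vertices and determinants of a family of lines\<close>

text \<open>The standard position in coordinates; \<open>offset_pos\<close> places the origin on the
  negative side of every line.\<close>

locale line_family =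
  fixes n :: nat and \<theta> d :: "nat \<Rightarrow> real" and L :: "nat \<Rightarrow> (real^2) set"
  assumes angle: "m \<in> {1..n} \<Longrightarrow> 0 < \<theta> m \<and> \<theta> m < pi"
    and angle_mono: "strict_mono_on {1..n} \<theta>"
    and offset_pos: "m \<in> {1..n} \<Longrightarrow> d m > 0"
    and line_eq: "m \<in> {1..n} \<Longrightarrow> L m = {x. normal (\<theta> m) \<bullet> x = d m}"
    and arrangement: "line_arrangement (L ` {1..n})"
begin

definition f :: "nat \<Rightarrow> real^2 \<Rightarrow> real" where
  "f m x = normal (\<theta> m) \<bullet> x - d m"

text \<open>The determinant of the directions, or equally of the normals, of lines \<open>p\<close>
  and \<open>q\<close>.\<close>

definition s :: "nat \<Rightarrow> nat \<Rightarrow> real" where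
  "s p q = sin (\<theta> q - \<theta> p)"

text \<open>Cramer's rule for the intersection point of lines \<open>p\<close> and
  \<open>q\<close>.\<close>

definition V :: "nat \<Rightarrow> nat \<Rightarrow> real^2" where
  "V p q = (1 / s p q) *\<^sub>R vector [cos (\<theta> p) * d q - cos (\<theta> q) * d p,
                               sin (\<theta> p) * d q - sin (\<theta> q) * d p]"

text \<open>Minus the 3x3 determinant whose rows are the coefficients of the normal followed by the
  offset.\<close>

definition D :: "nat \<Rightarrow> nat \<Rightarrow> nat \<Rightarrow> real" where
  "D p q r = - (s q r * d p + s r p * d q + s p q * d r)"

lemma mem_line: "m \<in> {1..n} \<Longrightarrow> x \<in> L m \<longleftrightarrow> f m x = 0"
  by (simp add: line_eq f_def)

lemma s_swap: "s q p = - s p q"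
  by (simp add: s_def sin_diff)

text \<open>Here the numbering by increasing angle enters: for \<open>p < q\<close> the difference
  of the angles lies strictly between 0 and \<open>pi\<close>.\<close>

lemma s_pos: "p \<in> {1..n} \<Longrightarrow> q \<in> {1..n} \<Longrightarrow> p < q \<Longrightarrow> s p q > 0"
  using angle[of p] angle[of q] strict_mono_onD[OF angle_mono, of p q]
  by (auto simp: s_def intro!: sin_gt_zero)

lemma sgn_s:
  assumes "p \<in> {1..n}" "q \<in> {1..n}"
  shows "sgn (s p q) = real_of_int (sgn (int q - int p))"
proof (cases p q rule: linorder_cases)
  case less
  then show ?thesis using s_pos[of p q] assms by simp
next
  case equal
  then show ?thesis by (simp add: s_def)
next
  case greater
  then show ?thesis using s_pos[of q p] s_swap[of p q] assms by simp
qed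

lemma s_nonzero: "p \<in> {1..n} \<Longrightarrow> q \<in> {1..n} \<Longrightarrow> p \<noteq> q \<Longrightarrow> s p q \<noteq> 0"
  using sgn_s[of p q] by (auto simp: sgn_if split: if_splits)

lemma V_swap: "V q p = V p q"
  by (simp add: V_def s_swap[of q p] vec_eq_iff forall_2 divide_simps)

lemma f_V: "s q r \<noteq> 0 \<Longrightarrow> f p (V q r) * s q r = D p q r"
  by (simp add: f_def V_def D_def inner_normal divide_simps)
     (simp add: s_def sin_diff algebra_simps)

lemma f_V_self:
  assumes "s q r \<noteq> 0"
  shows "f q (V q r) = 0" "f r (V q r) = 0"
  using f_V[OF assms, of q] f_V[OF assms, of r] assms
  by (simp_all add: D_def s_swap[of r q]) (simp_all add: s_def)

lemma eq_V:
  assumes "s p q \<noteq> 0" "f p x = 0" "f q x = 0"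
  shows "x = V p q"
proof -
  have dp: "d p = sin (\<theta> p) * x $ 1 - cos (\<theta> p) * x $ 2"
    and dq: "d q = sin (\<theta> q) * x $ 1 - cos (\<theta> q) * x $ 2"
    using assms by (auto simp: f_def inner_normal)
  have "s p q * x $ 1 = cos (\<theta> p) * d q - cos (\<theta> q) * d p"
    "s p q * x $ 2 = sin (\<theta> p) * d q - sin (\<theta> q) * d p"
    unfolding dp dq s_def sin_diff by (simp_all add: algebra_simps)
  then show ?thesis
    using assms(1) by (simp add: V_def vec_eq_iff forall_2 field_simps)
qed

lemma inj_L: "inj_on L {1..n}"
proof (rule inj_onI, rule ccontr)
  fix p q assume pq: "p \<in> {1..n}" "q \<in> {1..n}" "L p = L q" "p \<noteq> q"
  have s: "s p q \<noteq> 0" using pq s_nonzero by blast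
  \<comment> \<open>A unit step along line \<open>p\<close> away from the vertex: it stays on
    \<open>L p\<close>, while \<open>f q\<close> changes from 0 to \<open>s p q\<close>.\<close>
  define y where "y = V p q + vector [cos (\<theta> p), sin (\<theta> p)]"
  have "f p y = 0" "f q y = s p q"
    using f_V_self[OF s] by (simp_all add: y_def f_def inner_normal s_def sin_diff algebra_simps)
  then show False using s mem_line pq by metis
qed

text \<open>A zero would put the vertex of \<open>q\<close> and \<open>r\<close> on line
  \<open>p\<close>, making three lines concurrent.\<close>

lemma D_nonzero:
  assumes "p \<in> {1..n}" "q \<in> {1..n}" "r \<in> {1..n}" "p \<noteq> q" "p \<noteq> r" "q \<noteq> r"
  shows "D p q r \<noteq> 0"
proof
  assume "D p q r = 0"
  moreover have s: "s q r \<noteq> 0" using assms s_nonzero by blast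
  ultimately have "f p (V q r) = 0" using f_V[OF s, of p] by simp
  then have "V q r \<in> L p \<inter> L q \<inter> L r"
    using f_V_self[OF s] assms mem_line by auto
  moreover have "L p \<noteq> L q" "L p \<noteq> L r" "L q \<noteq> L r"
    using inj_L assms by (auto dest: inj_onD)
  ultimately show False
    using arrangement assms unfolding line_arrangement_def by blast
qed

lemma vertices_L:
  assumes "S \<subseteq> {1..n}"
  shows "vertices (L ` S) = {V p q | p q. p \<in> S \<and> q \<in> S \<and> p \<noteq> q}"
proof (intro set_eqI iffI)
  fix x assume "x \<in> vertices (L ` S)"
  then obtain p q where "p \<in> S" "q \<in> S" "L p \<noteq> L q" "x \<in> L p" "x \<in> L q"
    by (auto simp: vertices_def)
  then show "x \<in> {V p q | p q. p \<in> S \<and> q \<in> S \<and> p \<noteq> q}"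
    using assms mem_line eq_V s_nonzero
    by (smt (verit, best) mem_Collect_eq subset_eq)
next
  fix x assume "x \<in> {V p q | p q. p \<in> S \<and> q \<in> S \<and> p \<noteq> q}"
  then obtain p q where pq: "p \<in> S" "q \<in> S" "p \<noteq> q" "x = V p q" by auto
  with assms have "p \<in> {1..n}" "q \<in> {1..n}" by auto
  then have "L p \<noteq> L q" "x \<in> L p" "x \<in> L q"
    using pq inj_L s_nonzero[of p q] f_V_self[of p q] by (auto simp: mem_line dest: inj_onD)
  with pq show "x \<in> vertices (L ` S)" by (auto simp: vertices_def)
qed

lemma vertices_triple:
  assumes "p \<in> {1..n}" "q \<in> {1..n}" "r \<in> {1..n}" "p \<noteq> q" "p \<noteq> r" "q \<noteq> r"
  shows "vertices {L p, L q, L r} = {V p q, V p r, V q r}"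
  using vertices_L[of "{p, q, r}"] assms V_swap by auto

lemma f_combination:
  assumes "x + y + z = 1"
  shows "f m (x *\<^sub>R A + y *\<^sub>R B + z *\<^sub>R C) = x * f m A + y * f m B + z * f m C"
proof -
  have "d m = (x + y + z) * d m" using assms by simp
  then show ?thesis by (simp add: f_def inner_add_right algebra_simps)
qed

lemma D_cycle: "D q r p = D p q r"
  by (simp add: D_def)

lemma D_swap: "D q p r = - D p q r"
  by (simp add: D_def s_swap[of r p] s_swap[of r q] s_swap[of q p])

text \<open>Three normals in the plane are linearly dependent with these coefficients, so the
  combination does not vary with \<open>x\<close>. It will show that barycentric coordinates sum to
  1.\<close>

lemma f_relation: "s q r * f p x + s r p * f q x + s p q * f r x = D p q r"
proof -
  have "s q r * (normal (\<theta> p) \<bullet> x) + s r p * (normal (\<theta> q) \<bullet> x) + s p q * (normal (\<theta> r) \<bullet> x) = 0"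
    by (simp add: inner_normal s_def sin_diff algebra_simps)
  then show ?thesis by (simp add: f_def D_def algebra_simps)
qed

section \<open>The open triangle and its barycentric coordinates\<close>

text \<open>Each line of the triangle keeps the point on the side of the opposite corner.
  Inequalities are chosen because sign arguments then show maximality among connected sets.\<close>

definition open_triangle :: "nat \<Rightarrow> nat \<Rightarrow> nat \<Rightarrow> (real^2) set" where
  "open_triangle p q r = {x. f p x * f p (V q r) > 0 \<and> f q x * f q (V p r) > 0 \<and> f r x * f r (V p q) > 0}"

text \<open>Each line vanishes at two corners, so the barycentric coordinate at the third is the
  ratio of the line's value at the point to its value at that corner. \<open>f_relation\<close>
  makes the three ratios sum to 1.\<close>

lemma open_triangle_eq:
  assumes "p \<in> {1..n}" "q \<in> {1..n}" "r \<in> {1..n}" "p \<noteq> q" "p \<noteq> r" "q \<noteq> r"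
  shows "open_triangle p q r =
    {v. \<exists>x y z. 0 < x \<and> 0 < y \<and> 0 < z \<and> x + y + z = 1 \<and> x *\<^sub>R V p q + y *\<^sub>R V p r + z *\<^sub>R V q r = v}"
    (is "_ = ?R")
proof -
  have s: "s p q \<noteq> 0" "s p r \<noteq> 0" "s q r \<noteq> 0" using assms s_nonzero by auto
  have D: "D p q r \<noteq> 0" using assms D_nonzero by auto
  have fp: "f p (V q r) = D p q r / s q r" "f q (V p r) = - D p q r / s p r" "f r (V p q) = D p q r / s p q"
    unfolding nonzero_eq_divide_eq[OF s(1)] nonzero_eq_divide_eq[OF s(2)] nonzero_eq_divide_eq[OF s(3)]
    using f_V[OF s(3), of p] f_V[OF s(2), of q] f_V[OF s(1), of r] D_swap[of p q r] D_cycle[of p q r]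
    by linarith+
  note z = f_V_self[OF s(1)] f_V_self[OF s(2)] f_V_self[OF s(3)]
  have nz: "f p (V q r) \<noteq> 0" "f q (V p r) \<noteq> 0" "f r (V p q) \<noteq> 0"
    using fp D s by auto
  show ?thesis
  proof (intro set_eqI iffI)
    fix v assume "v \<in> ?R"
    then obtain x y w where c: "0 < x" "0 < y" "0 < w" "x + y + w = 1"
      and v: "v = x *\<^sub>R V p q + y *\<^sub>R V p r + w *\<^sub>R V q r" by auto
    have "f p v = w * f p (V q r)" "f q v = y * f q (V p r)" "f r v = x * f r (V p q)"
      unfolding v f_combination[OF c(4)] using z by simp_all
    then show "v \<in> open_triangle p q r"
      unfolding open_triangle_def using c nz by (auto simp: zero_less_mult_iff mult_less_0_iff linorder_neq_iff)
  next
    fix v assume v: "v \<in> open_triangle p q r"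
    define x y w where "x = f r v / f r (V p q)" and "y = f q v / f q (V p r)" and "w = f p v / f p (V q r)"
    have pos: "0 < x" "0 < y" "0 < w"
      using v unfolding open_triangle_def x_def y_def w_def
      by (auto simp: zero_less_mult_iff zero_less_divide_iff)
    have sum: "x + y + w = 1"
    proof -
      have "x + y + w = (s q r * f p v + s r p * f q v + s p q * f r v) / D p q r"
        unfolding x_def y_def w_def fp using D s s_swap[of r p] by (simp add: field_simps)
      then show ?thesis using f_relation D by simp
    qed
    define u where "u = x *\<^sub>R V p q + y *\<^sub>R V p r + w *\<^sub>R V q r"
    have u: "f p u = f p v" "f q u = f q v"
      unfolding u_def f_combination[OF sum] using z nz by (simp_all add: x_def y_def w_def)
    \<comment> \<open>The forms of lines \<open>p\<close> and \<open>q\<close> agree at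
      \<open>u\<close> and \<open>v\<close>, so shifting \<open>V p q\<close> by
      \<open>v - u\<close> stays on both lines; their intersection is unique, so the shift is
      0.\<close>
    have "v = u"
    proof -
      have "normal (\<theta> p) \<bullet> (v - u) = 0" "normal (\<theta> q) \<bullet> (v - u) = 0"
        using u by (simp_all add: f_def inner_diff_right)
      then have "f p (V p q + (v - u)) = 0" "f q (V p q + (v - u)) = 0"
        using z(1,2) by (simp_all add: f_def inner_add_right)
      from eq_V[OF s(1) this] show ?thesis by simp
    qed
    then show "v \<in> ?R" using pos sum unfolding u_def by blast
  qed
qed

text \<open>Otherwise \<open>V q r\<close> is an affine combination of two points of line
  \<open>p\<close>, and \<open>f p\<close> would vanish there too.\<close>

lemma vertices_not_collinear:
  assumes "p \<in> {1..n}" "q \<in> {1..n}" "r \<in> {1..n}" "p \<noteq> q" "p \<noteq> r" "q \<noteq> r"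
  shows "\<not> collinear {V p q, V p r, V q r}"
proof
  assume c: "collinear {V p q, V p r, V q r}"
  have s: "s p q \<noteq> 0" "s p r \<noteq> 0" "s q r \<noteq> 0" using assms s_nonzero by auto
  have D: "D p q r \<noteq> 0" using assms D_nonzero by auto
  have nz: "f p (V q r) \<noteq> 0" "f q (V p r) \<noteq> 0"
    using f_V[OF s(3), of p] f_V[OF s(2), of q] D D_swap[of p q r] by auto
  have "V p q \<noteq> V p r" using nz f_V_self[OF s(1)] by auto
  then obtain u where "V q r = u *\<^sub>R V p q + (1 - u) *\<^sub>R V p r"
    using c collinear_3_expand[of "V p q" "V q r" "V p r"] by (auto simp: insert_commute)
  then have "f p (V q r) = u * f p (V p q) + (1 - u) * f p (V p r)"
    using f_combination[of u "1 - u" 0 p "V p q" "V p r" 0] by simp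
  then show False using nz f_V_self[OF s(1)] f_V_self[OF s(2)] by simp
qed

lemma interior_triangle:
  assumes "p \<in> {1..n}" "q \<in> {1..n}" "r \<in> {1..n}" "p \<noteq> q" "p \<noteq> r" "q \<noteq> r"
  shows "interior (convex hull vertices {L p, L q, L r}) = open_triangle p q r"
  unfolding vertices_triple[OF assms] open_triangle_eq[OF assms]
  by (rule interior_convex_hull_3_minimal[OF vertices_not_collinear[OF assms]]) simp

lemma connected_constant_sign:
  assumes "connected S" "x \<in> S" "y \<in> S" "\<And>z. z \<in> S \<Longrightarrow> f m z \<noteq> 0" "f m x * c > 0"
  shows "f m y * c > 0"
proof -
  have "f m x * f m y > 0"
  proof (rule ccontr)
    assume "\<not> ?thesis"
    then have "f m x \<le> 0 \<and> 0 \<le> f m y \<or> f m y \<le> 0 \<and> 0 \<le> f m x"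
      by (smt (verit) mult_pos_pos mult_neg_neg)
    then show False
      using connected_ivt_hyperplane[OF assms(1), of x y "normal (\<theta> m)" "d m"]
        connected_ivt_hyperplane[OF assms(1), of y x "normal (\<theta> m)" "d m"] assms(2-4)
      unfolding f_def by auto
  qed
  with assms(5) show ?thesis by (auto simp: zero_less_mult_iff)
qed

text \<open>A connected set that avoids all lines and contains the open triangle keeps the signs of
  \<open>f p\<close>, \<open>f q\<close>, \<open>f r\<close>, hence lies within the triangle. So a
  triangle missed by all lines is a whole component.\<close>

lemma form_triangle_iff_disjoint:
  assumes pqr: "p \<in> {1..n}" "q \<in> {1..n}" "r \<in> {1..n}" "p \<noteq> q" "p \<noteq> r" "q \<noteq> r"
  shows "form_triangle (L ` {1..n}) (L p) (L q) (L r) \<longleftrightarrow>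
    (\<forall>m\<in>{1..n}. \<forall>x\<in>open_triangle p q r. f m x \<noteq> 0)"
proof -
  let ?T = "open_triangle p q r"
  let ?U = "- \<Union> (L ` {1..n})"
  have form: "form_triangle (L ` {1..n}) (L p) (L q) (L r) \<longleftrightarrow> ?T \<in> components ?U"
    unfolding form_triangle_def regions_def interior_triangle[OF pqr]
    using pqr inj_L by (auto dest: inj_onD)
  have sub: "?T \<subseteq> ?U \<longleftrightarrow> (\<forall>m\<in>{1..n}. \<forall>x\<in>?T. f m x \<noteq> 0)"
    using mem_line by auto
  have conn: "connected ?T"
    unfolding interior_triangle[OF pqr, symmetric]
    by (intro convex_connected convex_interior convex_convex_hull)
  have ne: "?T \<noteq> {}"
    unfolding open_triangle_eq[OF pqr]
    by (auto intro!: exI[of _ "1/3::real"])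
  have "?T \<in> components ?U" if "?T \<subseteq> ?U"
    unfolding in_components_maximal
  proof (intro conjI allI impI ne that conn)
    fix W assume W: "W \<noteq> {} \<and> ?T \<subseteq> W \<and> W \<subseteq> ?U \<and> connected W"
    obtain x where x: "x \<in> ?T" using ne by auto
    have nz: "f m y \<noteq> 0" if "m \<in> {1..n}" "y \<in> W" for m y
      using that W mem_line by blast
    have "y \<in> ?T" if y: "y \<in> W" for y
      using connected_constant_sign[of W x y] W x y nz pqr unfolding open_triangle_def by auto
    with W show "W = ?T" by blast
  qed
  then show ?thesis using form sub in_components_subset by blast
qed

section \<open>Signs of lines at vertices\<close>

text \<open>An integer sign, comparable with superscripts. Zero counts as -1, a default that does
  not occur at a vertex of two other lines.\<close>

definition side :: "nat \<Rightarrow> real^2 \<Rightarrow> int" where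
  "side m x = (if f m x > 0 then 1 else - 1)"

text \<open>The chirotope of the arrangement: the orientation of a triple of lines.\<close>

definition chi :: "nat \<Rightarrow> nat \<Rightarrow> nat \<Rightarrow> int" where
  "chi p q r = (if D p q r > 0 then 1 else - 1)"

definition e :: "nat \<Rightarrow> nat \<Rightarrow> int" where
  "e p q = sgn (int q - int p)"

lemma side_V:
  assumes "p \<in> {1..n}" "q \<in> {1..n}" "m \<in> {1..n}" "p \<noteq> q" "m \<noteq> p" "m \<noteq> q"
  shows "f m (V p q) \<noteq> 0" "side m (V p q) = chi m p q * e p q"
proof -
  have s: "s p q \<noteq> 0" using assms s_nonzero by auto
  have D: "D m p q \<noteq> 0" using assms D_nonzero by auto
  note fV = f_V[OF s, of m]
  show "f m (V p q) \<noteq> 0" using fV D by auto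
  show "side m (V p q) = chi m p q * e p q"
  proof (cases "p < q")
    case True
    then have "s p q > 0" "e p q = 1" using s_pos assms by (auto simp: e_def)
    then show ?thesis using fV unfolding side_def chi_def by (auto simp: zero_less_mult_iff simp flip: fV)
  next
    case False
    then have "s q p > 0" "e p q = - 1" using s_pos assms by (auto simp: e_def)
    then show ?thesis using fV D s_swap[of q p]
      unfolding side_def chi_def by (auto simp: zero_less_mult_iff simp flip: fV)
  qed
qed

lemma chi_cycle: "chi q r p = chi p q r"
  by (simp add: chi_def D_cycle)

lemma chi_swap:
  assumes "p \<in> {1..n}" "q \<in> {1..n}" "r \<in> {1..n}" "p \<noteq> q" "p \<noteq> r" "q \<noteq> r"
  shows "chi q p r = - chi p q r"
  using D_nonzero[OF assms] by (simp add: chi_def D_swap[of q p r])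

text \<open>The three bounding lines never meet the open triangle. Any other line is nonzero at the
  corners and misses the triangle exactly when these values share a sign, by
  \<open>positive_combination_zero_iff\<close>.\<close>

lemma form_triangle_iff:
  assumes pqr: "p \<in> {1..n}" "q \<in> {1..n}" "r \<in> {1..n}" "p \<noteq> q" "p \<noteq> r" "q \<noteq> r"
  shows "form_triangle (L ` {1..n}) (L p) (L q) (L r) \<longleftrightarrow>
    (\<forall>m\<in>{1..n} - {p, q, r}. side m (V p q) = side m (V p r) \<and> side m (V p q) = side m (V q r))"
proof -
  have own: "f m x \<noteq> 0" if "x \<in> open_triangle p q r" "m \<in> {p, q, r}" for m x
    using that by (auto simp: open_triangle_def)
  have other: "(\<forall>x\<in>open_triangle p q r. f m x \<noteq> 0) \<longleftrightarrow>
      side m (V p q) = side m (V p r) \<and> side m (V p q) = side m (V q r)"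
    if m: "m \<in> {1..n} - {p, q, r}" for m
  proof -
    have nz: "f m (V p q) \<noteq> 0" "f m (V p r) \<noteq> 0" "f m (V q r) \<noteq> 0"
      using side_V(1) pqr m by auto
    have "(\<exists>x\<in>open_triangle p q r. f m x = 0) \<longleftrightarrow>
       (\<exists>x y z. 0 < x \<and> 0 < y \<and> 0 < z \<and> x + y + z = 1 \<and>
          f m (x *\<^sub>R V p q + y *\<^sub>R V p r + z *\<^sub>R V q r) = 0)"
      unfolding open_triangle_eq[OF pqr] by blast
    also have "\<dots> \<longleftrightarrow>
       (\<exists>x y z. 0 < x \<and> 0 < y \<and> 0 < z \<and> x + y + z = 1 \<and>
          x * f m (V p q) + y * f m (V p r) + z * f m (V q r) = 0)"
      by (simp add: f_combination cong: conj_cong)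
    also note positive_combination_zero_iff[OF nz]
    finally show ?thesis using nz by (auto simp: side_def split: if_splits)
  qed
  show ?thesis
    unfolding form_triangle_iff_disjoint[OF pqr] using own other by blast
qed

section \<open>Superscripts as signs at vertices\<close>

lemma origin_separation:
  assumes m: "m \<in> {1..n}" and T: "H \<in> sides (L m)" "T \<subseteq> H" "t \<in> T"
  shows "(if separates (L m) {0} T then - 1 else 1) = - side m t"
  using separates_origin_iff[OF _ T(2,3), of "normal (\<theta> m)" "d m"] T(1) offset_pos[OF m]
  by (auto simp: line_eq[OF m] side_def f_def)

lemma in_some_side:
  assumes "m \<in> {1..n}" "f m x \<noteq> 0"
  obtains H where "H \<in> sides (L m)" "x \<in> H"
  using assms sidesI_less[of "normal (\<theta> m)" "d m"] sidesI_greater[of "normal (\<theta> m)" "d m"]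
    that[of "{x. normal (\<theta> m) \<bullet> x < d m}"] that[of "{x. d m < normal (\<theta> m) \<bullet> x}"]
  by (auto simp: line_eq f_def linorder_neq_iff)

lemma infinity_permutation_bij:
  assumes "infinity_permutation n L \<sigma>"
  shows "bij_betw \<sigma> {1..n} {1..n}" "l \<in> {1..n} \<Longrightarrow> \<sigma> l \<in> {1..n}"
    "l \<in> {1..n} \<Longrightarrow> m \<in> {1..n} \<Longrightarrow> \<sigma> l = \<sigma> m \<longleftrightarrow> l = m"
  using assms permutes_imp_bij[of \<sigma> "{1..n}"] permutes_inj[of \<sigma> "{1..n}"] permutes_in_image[of \<sigma> "{1..n}"]
  unfolding infinity_permutation_def by (auto simp: inj_def)

text \<open>Distinct indices give distinct lines, so the new line is not among the earlier ones and
  \<open>line_at_infinity\<close> yields an open side.\<close>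

lemma vertices_at_infinity:
  assumes \<sigma>: "infinity_permutation n L \<sigma>" and l: "l \<in> {2..n}"
  obtains H where "H \<in> sides (L (\<sigma> l))" "vertices (L ` \<sigma> ` {1..<l}) \<subseteq> H"
proof -
  have "L (\<sigma> l) \<noteq> L (\<sigma> m)" if "m \<in> {1..<l}" for m
  proof -
    have "\<sigma> m \<noteq> \<sigma> l" "\<sigma> m \<in> {1..n}" "\<sigma> l \<in> {1..n}"
      using infinity_permutation_bij[OF \<sigma>] that l by auto
    then show ?thesis using inj_onD[OF inj_L, of "\<sigma> m" "\<sigma> l"] by metis
  qed
  then have "L (\<sigma> l) \<notin> L ` \<sigma> ` {1..<l}" by blast
  moreover have "line_at_infinity (L (\<sigma> l)) (L ` \<sigma> ` {1..<l})"
    using \<sigma> l unfolding infinity_permutation_def by (simp add: image_image)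
  ultimately show ?thesis using that unfolding line_at_infinity_def by auto
qed

text \<open>All earlier vertices share a side, so any one of them may be used to read off the
  superscript.\<close>

lemma superscript_eq:
  assumes \<sigma>: "infinity_permutation n L \<sigma>" and l: "l \<in> {3..n}"
    and ij: "i \<in> {1..<l}" "j \<in> {1..<l}" "i \<noteq> j"
  shows "superscript L \<sigma> l = - side (\<sigma> l) (V (\<sigma> i) (\<sigma> j))"
proof -
  let ?T = "vertices (L ` \<sigma> ` {1..<l})"
  \<comment> \<open>For \<open>l = 3\<close> the other two of the first three lines are exactly the
    earlier ones.\<close>
  have "(if l \<le> 3 then {1, 2, 3} - {l} else {1..<l}) = {1..<l}"
    using l by auto
  then have sup: "superscript L \<sigma> l = (if separates (L (\<sigma> l)) {0} ?T then - 1 else 1)"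
    unfolding superscript_def by (simp add: image_image)
  obtain H where H: "H \<in> sides (L (\<sigma> l))" "?T \<subseteq> H"
    using vertices_at_infinity[OF \<sigma>, of l] l by auto
  have sub: "\<sigma> ` {1..<l} \<subseteq> {1..n}" using infinity_permutation_bij(2)[OF \<sigma>] l by fastforce
  have "\<sigma> i \<noteq> \<sigma> j" "\<sigma> l \<in> {1..n}"
    using infinity_permutation_bij[OF \<sigma>] ij l by auto
  then have "V (\<sigma> i) (\<sigma> j) \<in> ?T" unfolding vertices_L[OF sub] using ij by blast
  from origin_separation[OF \<open>\<sigma> l \<in> {1..n}\<close> H this] show ?thesis unfolding sup .
qed

text \<open>The vertex concerned involves the later line at position 3, so the infinity condition
  does not place it; but a single point off a line always lies in some side.\<close>

lemma superscript_2_eq: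
  assumes \<sigma>: "infinity_permutation n L \<sigma>" and n: "3 \<le> n"
  shows "superscript L \<sigma> 2 = - side (\<sigma> 2) (V (\<sigma> 1) (\<sigma> 3))"
proof -
  have in_n: "\<sigma> 1 \<in> {1..n}" "\<sigma> 2 \<in> {1..n}" "\<sigma> 3 \<in> {1..n}"
    and ne: "\<sigma> 1 \<noteq> \<sigma> 2" "\<sigma> 1 \<noteq> \<sigma> 3" "\<sigma> 2 \<noteq> \<sigma> 3"
    using infinity_permutation_bij[OF \<sigma>] n by auto
  have "{1, 2, 3} - {2} = {1, 3::nat}" by auto
  then have sup: "superscript L \<sigma> 2 =
      (if separates (L (\<sigma> 2)) {0} (vertices (L ` {\<sigma> 1, \<sigma> 3})) then - 1 else 1)"
    unfolding superscript_def by simp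
  have T: "vertices (L ` {\<sigma> 1, \<sigma> 3}) = {V (\<sigma> 1) (\<sigma> 3)}"
    using vertices_L[of "{\<sigma> 1, \<sigma> 3}"] in_n ne V_swap by auto
  obtain H where "H \<in> sides (L (\<sigma> 2))" "V (\<sigma> 1) (\<sigma> 3) \<in> H"
    using in_some_side[OF in_n(2)] side_V(1) in_n ne by metis
  then show ?thesis
    unfolding sup T by (intro origin_separation[OF in_n(2)]) auto
qed

lemma e_sign: "p \<noteq> q \<Longrightarrow> e p q = 1 \<or> e p q = - 1"
  by (auto simp: e_def sgn_if)

lemma e_swap: "e q p = - e p q"
  by (simp add: e_def sgn_if)

section \<open>The triangle condition in terms of superscripts\<close>

text \<open>The other lines are split by position: before \<open>j\<close>, between \<open>j\<close>
  and \<open>k\<close>, after \<open>k\<close>. The equation linking \<open>a j\<close> and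
  \<open>a k\<close> arises only from a line before \<open>j\<close>, so it is absent when
  \<open>i = 1\<close> and \<open>j = 2\<close>.\<close>

lemma form_triangle_iff_superscript:
  assumes \<sigma>: "infinity_permutation n L \<sigma>"
    and a: "\<forall>l\<in>{1..n}. a l = superscript L \<sigma> l"
    and ijk: "1 \<le> i" "i < j" "j < k" "k \<le> n"
  defines "E \<equiv> \<lambda>i j. e (\<sigma> i) (\<sigma> j)"
  shows "form_triangle (L ` {1..n}) (L (\<sigma> i)) (L (\<sigma> j)) (L (\<sigma> k)) \<longleftrightarrow>
    (\<forall>l. 1 \<le> l \<and> l < j \<and> l \<noteq> i \<longrightarrow>
       a j * E i j = a k * E i k \<and> E l i * E i k = E l j * E j k) \<and>
    (\<forall>l. j < l \<and> l < k \<longrightarrow> a l = a k * E l i * E i k \<and> a l = a k * E l j * E j k)"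
proof -
  let ?s = "\<lambda>l i j. side (\<sigma> l) (V (\<sigma> i) (\<sigma> j))"
  let ?N = "\<lambda>l. ?s l i j = ?s l i k \<and> ?s l i j = ?s l j k"
  note perm = infinity_permutation_bij[OF \<sigma>]
  have in_n: "\<sigma> i \<in> {1..n}" "\<sigma> j \<in> {1..n}" "\<sigma> k \<in> {1..n}"
    and ne: "\<sigma> i \<noteq> \<sigma> j" "\<sigma> i \<noteq> \<sigma> k" "\<sigma> j \<noteq> \<sigma> k"
    using perm ijk by auto
  have "{1..n} - {\<sigma> i, \<sigma> j, \<sigma> k} = \<sigma> ` ({1..n} - {i, j, k})"
    using perm ijk unfolding bij_betw_def by auto
  then have tri: "form_triangle (L ` {1..n}) (L (\<sigma> i)) (L (\<sigma> j)) (L (\<sigma> k)) \<longleftrightarrow>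
      (\<forall>l\<in>{1..n} - {i, j, k}. ?N l)"
    unfolding form_triangle_iff[OF in_n ne] by simp
  have sV: "?s l u v = chi (\<sigma> l) (\<sigma> u) (\<sigma> v) * E u v"
    if "l \<in> {1..n}" "u \<in> {1..n}" "v \<in> {1..n}" "l \<noteq> u" "l \<noteq> v" "u \<noteq> v" for l u v
    unfolding E_def using that perm by (intro side_V(2)) auto
  have a_side: "a l = - ?s l u v" if "l \<in> {3..n}" "u \<in> {1..<l}" "v \<in> {1..<l}" "u \<noteq> v" for l u v
    using superscript_eq[OF \<sigma> that] a that(1) by auto
  have E1: "E u v = 1 \<or> E u v = - 1" if "u \<in> {1..n}" "v \<in> {1..n}" "u \<noteq> v" for u v
    unfolding E_def using that perm by (intro e_sign) auto
  have Es: "E v u = - E u v" for u v unfolding E_def by (rule e_swap)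
  have a1: "a l = 1 \<or> a l = - 1" if "l \<in> {1..n}" for l
    using bspec[OF a that] by (auto simp: superscript_def)
  \<comment> \<open>The latest of three lines knows its side of the vertex of the other two. Cyclic
    invariance of \<open>chi\<close> transfers this to the side of an earlier line at a vertex on
    the latest one.\<close>
  have s_rot: "?s l u v = - a v * E l u * E u v"
    if "v \<in> {3..n}" "l \<in> {1..<v}" "u \<in> {1..<v}" "l \<noteq> u" for l u v
  proof -
    have "a v = - (chi (\<sigma> l) (\<sigma> u) (\<sigma> v) * E l u)"
      using a_side[OF that] sV[of v l u] that chi_cycle[of "\<sigma> l" "\<sigma> u" "\<sigma> v"] by auto
    moreover have "?s l u v = chi (\<sigma> l) (\<sigma> u) (\<sigma> v) * E u v"
      using that by (intro sV) auto
    ultimately show ?thesis using E1[of l u] that by auto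
  qed
  \<comment> \<open>All three corners are vertices of lines preceding position \<open>l\<close>,
    hence on one side of it.\<close>
  have late: "?N l" if "k < l" "l \<le> n" for l
    using a_side[of l i j] a_side[of l i k] a_side[of l j k] that ijk by auto
  have middle: "?N l \<longleftrightarrow> a l = a k * E l i * E i k \<and> a l = a k * E l j * E j k"
    if "j < l" "l < k" for l
  proof -
    have "?s l i j = - a l" using a_side[of l i j] that ijk by auto
    moreover have "?s l i k = - (a k * E l i * E i k)" "?s l j k = - (a k * E l j * E j k)"
      using s_rot[of k l i] s_rot[of k l j] that ijk by auto
    ultimately show ?thesis by (simp only: neg_equal_iff_equal)
  qed
  \<comment> \<open>Now \<open>j\<close> is the latest of \<open>l\<close>, \<open>i\<close>,
    \<open>j\<close>, so the corner of \<open>i\<close> and \<open>j\<close> is governed by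
    \<open>a j\<close> and the other two by \<open>a k\<close>. Cancelling \<open>E l i\<close>
    gives the first equation.\<close>
  have early: "?N l \<longleftrightarrow> a j * E i j = a k * E i k \<and> E l i * E i k = E l j * E j k"
    if "1 \<le> l" "l < j" "l \<noteq> i" for l
  proof -
    have "?s l i j = - a j * E l i * E i j" "?s l i k = - a k * E l i * E i k"
      "?s l j k = - a k * E l j * E j k"
      using s_rot[of j l i] s_rot[of k l i] s_rot[of k l j] that ijk by auto
    moreover have "E l i = 1 \<or> E l i = - 1" "E l j = 1 \<or> E l j = - 1"
      "a k = 1 \<or> a k = - 1" "a j = 1 \<or> a j = - 1"
      using E1[of l i] E1[of l j] a1[of k] a1[of j] that ijk by auto
    ultimately show ?thesis by auto
  qed
  show ?thesis
    unfolding tri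
  proof (intro iffI conjI allI impI ballI)
    fix l assume N: "\<forall>l\<in>{1..n} - {i, j, k}. ?N l" and l: "1 \<le> l \<and> l < j \<and> l \<noteq> i"
    from l ijk have "l \<in> {1..n} - {i, j, k}" by auto
    with N have "?N l" by blast
    with early[of l] l show "a j * E i j = a k * E i k" "E l i * E i k = E l j * E j k" by blast+
  next
    fix l assume N: "\<forall>l\<in>{1..n} - {i, j, k}. ?N l" and l: "j < l \<and> l < k"
    from l ijk have "l \<in> {1..n} - {i, j, k}" by auto
    with N have "?N l" by blast
    with middle[of l] l show "a l = a k * E l i * E i k" "a l = a k * E l j * E j k" by blast+
  next
    fix l assume C: "(\<forall>l. 1 \<le> l \<and> l < j \<and> l \<noteq> i \<longrightarrow>
         a j * E i j = a k * E i k \<and> E l i * E i k = E l j * E j k) \<and>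
      (\<forall>l. j < l \<and> l < k \<longrightarrow> a l = a k * E l i * E i k \<and> a l = a k * E l j * E j k)"
      and l: "l \<in> {1..n} - {i, j, k}"
    from l consider "1 \<le> l" "l < j" "l \<noteq> i" | "j < l" "l < k" | "k < l" "l \<le> n"
      by (metis DiffD1 DiffD2 atLeastAtMost_iff insertCI linorder_neqE_nat)
    then have "?N l"
    proof cases
      case 1
      with C have "a j * E i j = a k * E i k \<and> E l i * E i k = E l j * E j k" by blast
      with early[OF 1] show ?thesis by blast
    next
      case 2
      with C have "a l = a k * E l i * E i k \<and> a l = a k * E l j * E j k" by blast
      with middle[OF 2] show ?thesis by blast
    next
      case 3
      then show ?thesis by (rule late)
    qed
    then show "?s l i j = ?s l i k" "?s l i j = ?s l j k" by blast+
  qed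
qed

text \<open>Both superscripts record the orientation of the same triple. This supplies the link
  between \<open>a j\<close> and \<open>a k\<close> when \<open>i = 1\<close> and
  \<open>j = 2\<close>.\<close>

lemma superscript_3_eq:
  assumes \<sigma>: "infinity_permutation n L \<sigma>" and n: "3 \<le> n"
  shows "superscript L \<sigma> 3 = - superscript L \<sigma> 2 * e (\<sigma> 1) (\<sigma> 2) * e (\<sigma> 1) (\<sigma> 3)"
proof -
  have in_n: "\<sigma> 1 \<in> {1..n}" "\<sigma> 2 \<in> {1..n}" "\<sigma> 3 \<in> {1..n}"
    and ne: "\<sigma> 1 \<noteq> \<sigma> 2" "\<sigma> 1 \<noteq> \<sigma> 3" "\<sigma> 2 \<noteq> \<sigma> 3"
    using infinity_permutation_bij[OF \<sigma>] n by auto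
  have "superscript L \<sigma> 3 = - (chi (\<sigma> 3) (\<sigma> 1) (\<sigma> 2) * e (\<sigma> 1) (\<sigma> 2))"
    using superscript_eq[OF \<sigma>, of 3 1 2] side_V(2)[of "\<sigma> 1" "\<sigma> 2" "\<sigma> 3"] n in_n ne by auto
  moreover have "superscript L \<sigma> 2 = - (chi (\<sigma> 2) (\<sigma> 1) (\<sigma> 3) * e (\<sigma> 1) (\<sigma> 3))"
    using superscript_2_eq[OF \<sigma> n] side_V(2)[of "\<sigma> 1" "\<sigma> 3" "\<sigma> 2"] in_n ne by auto
  moreover have "chi (\<sigma> 2) (\<sigma> 1) (\<sigma> 3) = - chi (\<sigma> 3) (\<sigma> 1) (\<sigma> 2)"
    using chi_swap[of "\<sigma> 1" "\<sigma> 2" "\<sigma> 3"] chi_cycle[of "\<sigma> 1" "\<sigma> 2" "\<sigma> 3"] in_n ne by simp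
  ultimately show ?thesis using e_sign[OF ne(2)] by auto
qed

end

section \<open>From the standard position to coordinates\<close>

lemma numbered_arrangement_line_family:
  assumes "numbered_arrangement n L"
  obtains \<theta> d where "line_family n \<theta> d L"
proof -
  obtain \<theta> where \<theta>: "\<And>m. m \<in> {1..n} \<Longrightarrow> 0 < \<theta> m \<and> \<theta> m < pi \<and> has_angle (L m) (\<theta> m)"
      "strict_mono_on {1..n} \<theta>"
    using assms unfolding numbered_arrangement_def by blast
  have "\<forall>m\<in>{1..n}. \<exists>d. L m = {x. normal (\<theta> m) \<bullet> x = d}"
    using \<theta>(1) has_angle_hyperplane by metis
  then obtain d where d: "\<And>m. m \<in> {1..n} \<Longrightarrow> L m = {x. normal (\<theta> m) \<bullet> x = d m}"
    by metis
  have "d m > 0" if m: "m \<in> {1..n}" for m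
  proof -
    obtain x where "x > 0" "vector [x, 0] \<in> L m"
      using assms m unfolding numbered_arrangement_def by blast
    then have "d m = sin (\<theta> m) * x" "x > 0" by (auto simp: d[OF m] inner_normal)
    then show ?thesis using \<theta>(1)[OF m] sin_gt_zero by auto
  qed
  then have "line_family n \<theta> d L"
    using \<theta> d assms unfolding line_family_def numbered_arrangement_def by blast
  then show ?thesis by (rule that)
qed

section \<open>The order conditions as sign relations\<close>

text \<open>Injectivity keeps \<sigma> l off both end values for \<open>l\<close> other than
  \<open>i\<close> and \<open>j\<close>, so both differences are nonzero; they share a sign exactly
  when \<sigma> l is outside the interval.\<close>

lemma none_strictly_between_iff:
  assumes "inj_on \<sigma> {1..k}" "i \<in> {1..k}" "j \<in> {1..k}"
  shows "none_strictly_between \<sigma> i j k \<longleftrightarrow>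
    (\<forall>l\<in>{1..k} - {i, j}. sgn (int (\<sigma> i) - int (\<sigma> l)) = sgn (int (\<sigma> j) - int (\<sigma> l)))"
proof -
  have "none_strictly_between \<sigma> i j k \<longleftrightarrow>
      (\<forall>l\<in>{1..k}. \<not> (min (\<sigma> i) (\<sigma> j) < \<sigma> l \<and> \<sigma> l < max (\<sigma> i) (\<sigma> j)))"
    unfolding none_strictly_between_def by auto
  also have "\<dots> \<longleftrightarrow> (\<forall>l\<in>{1..k} - {i, j}. \<not> (min (\<sigma> i) (\<sigma> j) < \<sigma> l \<and> \<sigma> l < max (\<sigma> i) (\<sigma> j)))"
    by (auto simp: min_def max_def)
  also have "\<dots> \<longleftrightarrow>
      (\<forall>l\<in>{1..k} - {i, j}. sgn (int (\<sigma> i) - int (\<sigma> l)) = sgn (int (\<sigma> j) - int (\<sigma> l)))"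
  proof (intro ball_cong refl)
    fix l assume "l \<in> {1..k} - {i, j}"
    then have "\<sigma> l \<noteq> \<sigma> i" "\<sigma> l \<noteq> \<sigma> j" using assms by (auto dest: inj_onD)
    then show "(\<not> (min (\<sigma> i) (\<sigma> j) < \<sigma> l \<and> \<sigma> l < max (\<sigma> i) (\<sigma> j))) =
        (sgn (int (\<sigma> i) - int (\<sigma> l)) = sgn (int (\<sigma> j) - int (\<sigma> l)))"
      by (auto simp: sgn_if min_def max_def)
  qed
  finally show ?thesis .
qed

lemma all_between_iff:
  assumes "inj_on \<sigma> {1..k}" "i \<in> {1..k}" "j \<in> {1..k}"
  shows "all_between \<sigma> i j k \<longleftrightarrow>
    (\<forall>l\<in>{1..k} - {i, j}. sgn (int (\<sigma> i) - int (\<sigma> l)) = - sgn (int (\<sigma> j) - int (\<sigma> l)))"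
proof -
  have "all_between \<sigma> i j k \<longleftrightarrow>
      (\<forall>l\<in>{1..k}. min (\<sigma> i) (\<sigma> j) \<le> \<sigma> l \<and> \<sigma> l \<le> max (\<sigma> i) (\<sigma> j))"
    unfolding all_between_def by auto
  also have "\<dots> \<longleftrightarrow> (\<forall>l\<in>{1..k} - {i, j}. min (\<sigma> i) (\<sigma> j) \<le> \<sigma> l \<and> \<sigma> l \<le> max (\<sigma> i) (\<sigma> j))"
    by (auto simp: min_def max_def)
  also have "\<dots> \<longleftrightarrow>
      (\<forall>l\<in>{1..k} - {i, j}. sgn (int (\<sigma> i) - int (\<sigma> l)) = - sgn (int (\<sigma> j) - int (\<sigma> l)))"
  proof (intro ball_cong refl)
    fix l assume "l \<in> {1..k} - {i, j}"
    then have "\<sigma> l \<noteq> \<sigma> i" "\<sigma> l \<noteq> \<sigma> j" using assms by (auto dest: inj_onD)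
    then show "(min (\<sigma> i) (\<sigma> j) \<le> \<sigma> l \<and> \<sigma> l \<le> max (\<sigma> i) (\<sigma> j)) =
        (sgn (int (\<sigma> i) - int (\<sigma> l)) = - sgn (int (\<sigma> j) - int (\<sigma> l)))"
      by (auto simp: sgn_if min_def max_def)
  qed
  finally show ?thesis .
qed

section \<open>The computation with signs\<close>

text \<open>\<open>E\<close> abstracts the order of the values of \<sigma>, with \<open>Et\<close>
  its transitivity. Under \<open>C\<close> the products \<open>E l i * E l j\<close> all equal
  \<open>E i k * E j k\<close>; its sign selects \<open>outlying\<close> or
  \<open>enclosed\<close>.\<close>

lemma sign_conditions_iff:
  fixes E :: "nat \<Rightarrow> nat \<Rightarrow> int" and a :: "nat \<Rightarrow> int"
  assumes E1: "\<forall>u\<in>{1..k}. \<forall>v\<in>{1..k}. u \<noteq> v \<longrightarrow> E u v = 1 \<or> E u v = - 1"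
    and Es: "\<forall>u v. E v u = - E u v"
    and Et: "\<forall>u v w. E u v = E v w \<longrightarrow> E u w = E u v"
    and a1: "\<forall>l\<in>{1..k}. a l = 1 \<or> a l = - 1"
    and a3: "a 3 = - a 2 * E 1 2 * E 1 3"
    and ijk: "1 \<le> i" "i < j" "j < k"
  defines "outlying \<equiv> \<forall>l\<in>{1..k} - {i, j}. E l i = E l j"
    and "enclosed \<equiv> \<forall>l\<in>{1..k} - {i, j}. E l i = - E l j"
    and "C \<equiv> (\<forall>l. 1 \<le> l \<and> l < j \<and> l \<noteq> i \<longrightarrow>
       a j * E i j = a k * E i k \<and> E l i * E i k = E l j * E j k) \<and>
      (\<forall>l. j < l \<and> l < k \<longrightarrow> a l = a k * E l i * E i k \<and> a l = a k * E l j * E j k)"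
  shows "C \<longrightarrow> outlying \<or> enclosed"
    and "C \<longleftrightarrow> i = 1 \<and> j = 2 \<and> k = 3 \<or>
      outlying \<and> a k = a j * E i j * E j k \<and> (\<forall>l. j < l \<and> l < k \<longrightarrow> a l = - (a j * E i j * E j l)) \<or>
      enclosed \<and> a k = a j \<and> (\<forall>l. j < l \<and> l < k \<longrightarrow> a l = - a j)"
proof -
  note E1 = E1[rule_format] and Es = Es[rule_format] and Et = Et[rule_format] and a1 = a1[rule_format]
  have ak: "a k = 1 \<or> a k = - 1"
    and ik: "E i k = 1 \<or> E i k = - 1" and jk: "E j k = 1 \<or> E j k = - 1"
    using a1[of k] E1[of i k] E1[of j k] ijk by auto
  have ki: "E k i = - E i k" and kj: "E k j = - E j k" by (rule Es)+
  have product: "E l i * E i k = E l j * E j k" if C "l \<in> {1..k} - {i, j, k}" for l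
  proof -
    have "l < j \<or> j < l \<and> l < k" using that(2) by auto
    then show ?thesis
      using that ak unfolding C_def by (elim disjE) (force simp: mult.assoc)+
  qed
  have out: outlying if C "E i k = E j k"
    unfolding outlying_def
  proof
    fix l assume l: "l \<in> {1..k} - {i, j}"
    show "E l i = E l j"
      using product[OF that(1), of l] that(2) l ik ki kj by (cases "l = k") auto
  qed
  have ins: enclosed if C "E i k = - E j k"
    unfolding enclosed_def
  proof
    fix l assume l: "l \<in> {1..k} - {i, j}"
    show "E l i = - E l j"
      using product[OF that(1), of l] that(2) l jk ki kj by (cases "l = k") auto
  qed
  have dich: "E i k = E j k \<or> E i k = - E j k" using ik jk by auto
  with out ins show "C \<longrightarrow> outlying \<or> enclosed" by blast
  \<comment> \<open>For \<open>j = 2\<close> the line at position 3 lies between \<open>j\<close>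
    and \<open>k\<close>, and \<open>a3\<close> relates its superscript to \<open>a 2\<close>.
    Otherwise some position before \<open>j\<close> differs from \<open>i\<close>, and
    \<open>C\<close> gives the equation directly.\<close>
  have key: "a k = a j * E i j * E i k" if C "\<not> (i = 1 \<and> j = 2 \<and> k = 3)"
  proof (cases "j = 2")
    case True
    with that(2) ijk have i: "i = 1" and k: "3 < k" by auto
    have "a 3 = a k * E 3 1 * E 1 k" using that(1) k True i unfolding C_def by auto
    moreover have "E 1 3 = 1 \<or> E 1 3 = - 1" using E1[of 1 3] k by auto
    ultimately show ?thesis
      using a3 Es[of 1 3] True i ak ik by auto
  next
    case False
    define l :: nat where "l = (if i = 1 then 2 else 1)"
    have "1 \<le> l \<and> l < j \<and> l \<noteq> i" using False ijk by (auto simp: l_def)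
    with that(1) have "a j * E i j = a k * E i k" unfolding C_def by blast
    then show ?thesis using ik by auto
  qed
  show "C \<longleftrightarrow> i = 1 \<and> j = 2 \<and> k = 3 \<or>
      outlying \<and> a k = a j * E i j * E j k \<and> (\<forall>l. j < l \<and> l < k \<longrightarrow> a l = - (a j * E i j * E j l)) \<or>
      enclosed \<and> a k = a j \<and> (\<forall>l. j < l \<and> l < k \<longrightarrow> a l = - a j)" (is "_ \<longleftrightarrow> ?first \<or> ?out \<or> ?ins")
  proof
    assume C: C
    show "?first \<or> ?out \<or> ?ins"
    proof (cases ?first)
      case False
      note ak_eq = key[OF C False]
      have mid: "a l = a k * E l j * E j k" if "j < l" "l < k" for l
        using C that unfolding C_def by blast
      from dich show ?thesis
      proof
        assume eq: "E i k = E j k"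
        have "a l = - (a j * E i j * E j l)" if "j < l" "l < k" for l
          using mid[OF that] ak_eq eq Es[of l j] jk by auto
        with out[OF C eq] ak_eq eq show ?thesis by auto
      next
        assume eq: "E i k = - E j k"
        have i: enclosed by (rule ins[OF C eq])
        \<comment> \<open>The value at \<open>k\<close> lies between those at \<open>i\<close> and
          \<open>j\<close>, so both are reached from \<open>i\<close> in the same direction.\<close>
        have ijk_eq: "E i j = E i k" using Et[of i k j] eq kj by simp
        have "a k = a j" using ak_eq ijk_eq ik by auto
        moreover have "a l = - a j" if "j < l" "l < k" for l
        proof -
          have "E l i = - E l j" using i that ijk unfolding enclosed_def by auto
          then have "E l j = - E j k" using Et[of i l j] Es[of l i] ijk_eq eq by simp
          then show ?thesis
            using mid[OF that] \<open>a k = a j\<close> jk by auto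
        qed
        ultimately show ?thesis using i by blast
      qed
    qed blast
  next
    assume "?first \<or> ?out \<or> ?ins"
    then consider ?first | ?out | ?ins by blast
    then show C
    proof cases
      case 1
      \<comment> \<open>No position before 2 differs from 1 and none lies strictly between 2 and 3,
        so both parts of \<open>C\<close> are vacuous.\<close>
      then show ?thesis unfolding C_def by auto
    next
      case 2
      then have eq: "E l i = E l j" if "1 \<le> l" "l \<le> k" "l \<noteq> i" "l \<noteq> j" for l
        using that unfolding outlying_def by auto
      have k: "E i k = E j k" using eq[of k] ijk ki kj by auto
      have ak_eq: "a k = a j * E i j * E j k" using 2 by blast
      show ?thesis
        unfolding C_def
      proof (intro conjI allI impI)
        fix l assume "1 \<le> l \<and> l < j \<and> l \<noteq> i"
        then show "a j * E i j = a k * E i k" "E l i * E i k = E l j * E j k"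
          using ak_eq k jk eq[of l] ijk by auto
      next
        fix l assume l: "j < l \<and> l < k"
        then have "a l = - (a j * E i j * E j l)" using 2 by blast
        then have "a l = a k * E l j * E j k" using ak_eq jk Es[of j l] by auto
        then show "a l = a k * E l i * E i k" "a l = a k * E l j * E j k"
          using k eq[of l] l ijk by auto
      qed
    next
      case 3
      then have eq: "E l i = - E l j" "E i j = E l j"
        if "1 \<le> l" "l \<le> k" "l \<noteq> i" "l \<noteq> j" for l
        using that Et[of i l j] Es[of l i] unfolding enclosed_def by auto
      have k: "E i k = - E j k" "E i j = - E j k" using eq[of k] ijk ki kj by auto
      have ak_eq: "a k = a j" using 3 by blast
      show ?thesis
        unfolding C_def
      proof (intro conjI allI impI)
        fix l assume "1 \<le> l \<and> l < j \<and> l \<noteq> i"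
        then show "a j * E i j = a k * E i k" "E l i * E i k = E l j * E j k"
          using ak_eq k eq[of l] ijk by auto
      next
        fix l assume l: "j < l \<and> l < k"
        then have "a l = - a j" "E l j = - E j k" using 3 k eq(2)[of l] ijk by auto
        then have "a l = a k * E l j * E j k" using ak_eq jk by auto
        then show "a l = a k * E l i * E i k" "a l = a k * E l j * E j k"
          using k eq[of l] l ijk by auto
      qed
    qed
  qed
qed

section \<open>The criterion for triangles\<close>

theorem theoremB:
  fixes n i j k :: nat
    and L :: "nat \<Rightarrow> (real^2) set"
    and \<sigma> :: "nat \<Rightarrow> nat"
    and a :: "nat \<Rightarrow> int"
  assumes "n \<ge> 3"
    and "numbered_arrangement n L"
    and "infinity_type n L"
    and "infinity_permutation n L \<sigma>"
    and "nomenclature n L \<sigma> = map (\<lambda>l. (\<sigma> l, a l)) [1..<Suc n]"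
    and "1 \<le> i" "i < j" "j < k" "k \<le> n"
  shows "(form_triangle (L ` {1..n}) (L (\<sigma> i)) (L (\<sigma> j)) (L (\<sigma> k)) \<longrightarrow>
            none_strictly_between \<sigma> i j k \<or> all_between \<sigma> i j k) \<and>
         (form_triangle (L ` {1..n}) (L (\<sigma> i)) (L (\<sigma> j)) (L (\<sigma> k)) \<longleftrightarrow>
            (i = 1 \<and> j = 2 \<and> k = 3) \<or>
            (none_strictly_between \<sigma> i j k \<and>
              a k = sgn (a j * (int (\<sigma> j) - int (\<sigma> i)) * (int (\<sigma> k) - int (\<sigma> j))) \<and>
              (\<forall>l. j < l \<and> l < k \<longrightarrow>
                a l = - sgn (a j * (int (\<sigma> j) - int (\<sigma> i)) * (int (\<sigma> l) - int (\<sigma> j))))) \<or>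
            (all_between \<sigma> i j k \<and>
              a k = a j \<and>
              (\<forall>l. j < l \<and> l < k \<longrightarrow> a l = - sgn (a j))))"
proof -
  obtain \<theta> d where "line_family n \<theta> d L"
    using numbered_arrangement_line_family[OF assms(2)] .
  then interpret line_family n \<theta> d L .
  define E where "E = (\<lambda>u v. e (\<sigma> u) (\<sigma> v))"
  have E_sgn: "sgn (int (\<sigma> v) - int (\<sigma> u)) = E u v" for u v
    by (simp add: E_def e_def)
  have E_app: "e (\<sigma> u) (\<sigma> v) = E u v" for u v
    by (simp add: E_def)
  note \<sigma> = assms(4) and perm = infinity_permutation_bij[OF assms(4)]
  \<comment> \<open>Comparing the two nomenclature lists entry by entry identifies \<open>a\<close>
    with the superscripts on \<open>{1..n}\<close>.\<close>
  have "\<forall>l\<in>set [1..<Suc n]. (\<sigma> l, superscript L \<sigma> l) = (\<sigma> l, a l)"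
    using assms(5) unfolding nomenclature_def map_eq_conv .
  then have a: "\<forall>l\<in>{1..n}. a l = superscript L \<sigma> l" by (auto simp del: upt_Suc)
  then have a1: "\<forall>l\<in>{1..k}. a l = 1 \<or> a l = - 1"
    using assms(9) by (simp add: superscript_def)
  have E1: "\<forall>u\<in>{1..k}. \<forall>v\<in>{1..k}. u \<noteq> v \<longrightarrow> E u v = 1 \<or> E u v = - 1"
    unfolding E_def using perm(3) assms(9) by (intro ballI impI e_sign) auto
  have Es: "\<forall>u v. E v u = - E u v" unfolding E_def using e_swap by blast
  have Et: "\<forall>u v w. E u v = E v w \<longrightarrow> E u w = E u v"
    unfolding E_def e_def by (auto simp: sgn_if split: if_splits)
  have a3: "a 3 = - a 2 * E 1 2 * E 1 3"
    using superscript_3_eq[OF \<sigma> assms(1)] a assms(1) by (simp add: E_def)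
  have inj: "inj_on \<sigma> {1..k}"
    using perm(3) assms(9) by (auto intro!: inj_onI)
  have mem: "i \<in> {1..k}" "j \<in> {1..k}" using assms by auto
  have sgn_a: "sgn (a l) = a l" if "l \<in> {1..k}" for l using bspec[OF a1 that] by auto
  \<comment> \<open>The sign is multiplicative and fixes \<open>a j\<close>, which is 1 or
    -1.\<close>
  have sgn_aj: "sgn (a j * (int (\<sigma> j) - int (\<sigma> i)) * (int (\<sigma> l) - int (\<sigma> j))) = a j * E i j * E j l" for l
    by (simp add: sgn_mult sgn_a[OF mem(2)] E_sgn)
  note conditions = sign_conditions_iff[OF E1 Es Et a1 a3 assms(6-8)]
  note triangle = form_triangle_iff_superscript[OF \<sigma> a assms(6-9), unfolded E_app]
  note order = none_strictly_between_iff[OF inj mem, unfolded E_sgn]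
    all_between_iff[OF inj mem, unfolded E_sgn]
  show ?thesis
    unfolding sgn_aj sgn_a[OF mem(2)] order triangle by (rule conjI[OF conditions])
qed

end
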